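(* Let $X$ be a time-homogeneous Markov chain of order $m\ge 1$ on a finite alphabet $A$, with transition kernel $p$, whose skeleton has order $K$ and whose skeleton matrix is $\mathbb{M}$. If $\mathbb{M}$ has a unique closed class, then $X$ is essentially irreducible.
   Context: Words: $A$ is a finite set. For $\mathbf{x}\in A^k$, $\mathbf{x}_i^j=(x_i,\dots,x_j)$ for $1\le i\le j\le k$, and $\mathbf{x}_i^j=\mathbf{e}$ (the empty word) if $i>j$; $A^0=\{\mathbf{e}\}$. Juxtaposition denotes concatenation. Kernel: $p:A^m\times A\to[0,1]$, $p(\mathbf{x},a)=P(X_{n+1}=a\mid X_n=x_m,X_{n-1}=x_{m-1},\dots,X_{n-m+1}=x_1)$, so $x_m$ is the most recent symbol, and $\sum_{a\in A}p(\mathbf{x},a)=1$. The stochastic matrix $\mathbb{P}$ on $A^m$ is given by $\mathbb{P}(\mathbf{x},\mathbf{x}_2^m a)=p(\mathbf{x},a)$ for $\mathbf{x}\in A^m$, $a\in A$, all other entries being $0$. Essential irreducibility: $X$ is essentially irreducible if $\mathbb{P}$ has a unique recurrent class (a closed communicating class); transient states are allowed. Skeleton order: for $\mathbf{x}\in A^m$ and $a\in A$, $$\tau(\mathbf{x},a)=\min\{i\ge 0:\ p(\mathbf{y}\mathbf{x}_{m-i}^m,a)=0\ \forall \mathbf{y}\in A^{m-i-1},\ \text{or}\ p(\mathbf{y}\mathbf{x}_{m-i}^m,a)>0\ \forall \mathbf{y}\in A^{m-i-1}\},$$ $\tau_{\mathbf{x}}=\sup_{a\in A}\tau(\mathbf{x},a)$.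 The skeleton of $p$ is $\mathcal{S}=\bigcup_{\mathbf{x}\in A^m}\{\mathbf{x}_{m-\tau_{\mathbf{x}}}^m\}$ and its order is $K=1+\sup_{\mathbf{x}\in A^m}\tau_{\mathbf{x}}\in\{1,\dots,m\}$. Skeleton matrix: $\mathbb{M}$ is the $\{0,1\}$-matrix indexed by $A^K\times A^K$ with $\mathbb{M}(\mathbf{u},\mathbf{v})=1$ if $(\mathbf{u},\mathbf{v})=(\mathbf{x}_1^K,\mathbf{x}_2^K a)$ for some $\mathbf{x}\in A^K$, $a\in A$ such that $p(\mathbf{y}\mathbf{x}_1^K,a)>0$ for all $\mathbf{y}\in A^{m-K}$, and $\mathbb{M}(\mathbf{u},\mathbf{v})=0$ otherwise. Classes: powers of $\{0,1\}$-matrices are Boolean ($1+1=1$). For a binary matrix $B$ on a finite set $E$, communicating classes are defined as for stochastic matrices (accessibility of $l$ from $k$ meaning $B^n(k,l)=1$ for some $n\ge0$). A communicating class $\mathcal{C}$ is closed if $B^n(k,l)=0$ for all $k\in\mathcal{C}$, $l\notin\mathcal{C}$, $n\ge1$. *)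

theory Defs
  imports "HOL-Probability.Probability_Measure" "HOL-Library.NList"
begin

text \<open>
  \<open>A\<^sup>n\<close> is \<open>nlists n A\<close>. A word \<open>x\<^sub>1 \<dots> x\<^sub>m\<close> is the list \<open>[x\<^sub>1, \<dots>, x\<^sub>m]\<close>, whose last element is the
  most recent symbol.
\<close>

definition kernel :: "'a set \<Rightarrow> nat \<Rightarrow> ('a list \<Rightarrow> 'a \<Rightarrow> real) \<Rightarrow> bool" where
  "kernel A m p \<longleftrightarrow>
     (\<forall>x\<in>nlists m A. (\<forall>a\<in>A. p x a \<in> {0..1}) \<and> (\<Sum>a\<in>A. p x a) = 1)"

text \<open>
  Time runs through \<open>0, 1, 2, \<dots>\<close>. The law of the first \<open>m\<close> symbols is arbitrary, and the kernel is
  prescribed also at words that the chain visits with probability \<open>0\<close>.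
\<close>

definition markov_chain ::
    "'a set \<Rightarrow> nat \<Rightarrow> ('a list \<Rightarrow> 'a \<Rightarrow> real) \<Rightarrow> 'b measure \<Rightarrow> (nat \<Rightarrow> 'b \<Rightarrow> 'a) \<Rightarrow> bool" where
  "markov_chain A m p \<Omega> X \<longleftrightarrow>
     kernel A m p \<and> prob_space \<Omega> \<and> (\<forall>n. X n \<in> measurable \<Omega> (count_space A)) \<and>
     (\<forall>n\<ge>m. \<forall>w\<in>nlists n A. \<forall>a\<in>A.
        \<P>(\<omega> in \<Omega>. \<forall>i<n. X i \<omega> = w ! i) > 0 \<longrightarrow>
        \<P>(\<omega> in \<Omega>. X n \<omega> = a \<bar> \<forall>i<n. X i \<omega> = w ! i) = p (drop (n - m) w) a)"

definition transition_matrix ::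
    "'a set \<Rightarrow> nat \<Rightarrow> ('a list \<Rightarrow> 'a \<Rightarrow> real) \<Rightarrow> 'a list \<Rightarrow> 'a list \<Rightarrow> real" where
  "transition_matrix A m p x z =
     (if x \<in> nlists m A \<and> (\<exists>a\<in>A. z = tl x @ [a]) then p x (last z) else 0)"

primrec matrix_power :: "'i set \<Rightarrow> ('i \<Rightarrow> 'i \<Rightarrow> real) \<Rightarrow> nat \<Rightarrow> 'i \<Rightarrow> 'i \<Rightarrow> real" where
  "matrix_power E P 0 k l = (if k = l then 1 else 0)"
| "matrix_power E P (Suc n) k l = (\<Sum>j\<in>E. matrix_power E P n k j * P j l)"

text \<open>
  Communicating classes depend on a matrix with index set \<open>E\<close> only through the positions of the
  positive entries of its powers; \<open>Q n k l\<close> says that the \<open>(k, l)\<close> entry of the \<open>n\<close>-th power is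
  positive. This serves stochastic and binary matrices alike.
\<close>

definition accessible :: "(nat \<Rightarrow> 'i \<Rightarrow> 'i \<Rightarrow> bool) \<Rightarrow> 'i \<Rightarrow> 'i \<Rightarrow> bool" where
  "accessible Q k l \<longleftrightarrow> (\<exists>n. Q n k l)"

definition communicating_classes :: "'i set \<Rightarrow> (nat \<Rightarrow> 'i \<Rightarrow> 'i \<Rightarrow> bool) \<Rightarrow> 'i set set" where
  "communicating_classes E Q =
     E // {(k, l). k \<in> E \<and> l \<in> E \<and> accessible Q k l \<and> accessible Q l k}"

definition closed_class :: "'i set \<Rightarrow> (nat \<Rightarrow> 'i \<Rightarrow> 'i \<Rightarrow> bool) \<Rightarrow> 'i set \<Rightarrow> bool" where
  "closed_class E Q C \<longleftrightarrow>
     C \<in> communicating_classes E Q \<and> (\<forall>k\<in>C. \<forall>l\<in>E - C. \<forall>n\<ge>1. \<not> Q n k l)"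

definition recurrent_class :: "'i set \<Rightarrow> ('i \<Rightarrow> 'i \<Rightarrow> real) \<Rightarrow> 'i set \<Rightarrow> bool" where
  "recurrent_class E P C \<longleftrightarrow> closed_class E (\<lambda>n k l. matrix_power E P n k l > 0) C"

definition essentially_irreducible :: "'a set \<Rightarrow> nat \<Rightarrow> ('a list \<Rightarrow> 'a \<Rightarrow> real) \<Rightarrow> bool" where
  "essentially_irreducible A m p \<longleftrightarrow>
     (\<exists>!C. recurrent_class (nlists m A) (transition_matrix A m p) C)"

text \<open>
  A binary matrix is a predicate that is false outside \<open>E \<times> E\<close>. The Boolean matrix product is then
  relational composition, and the \<open>n\<close>-th Boolean power is the relational power \<open>B ^^ n\<close>.
\<close>

definition binary_closed_class :: "'i set \<Rightarrow> ('i \<Rightarrow> 'i \<Rightarrow> bool) \<Rightarrow> 'i set \<Rightarrow> bool" where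
  "binary_closed_class E B C \<longleftrightarrow> closed_class E (\<lambda>n. B ^^ n) C"

text \<open>
  For \<open>x \<in> A\<^sup>m\<close> and \<open>i < m\<close>, the suffix \<open>x\<^sub>m\<^sub>-\<^sub>i \<dots> x\<^sub>m\<close> (of length \<open>i + 1\<close>) is \<open>drop (m - i - 1) x\<close>.
  The minimum exists, since \<open>i = m - 1\<close> always qualifies, and the suprema below are over
  finite sets of natural numbers.
\<close>

definition tau :: "'a set \<Rightarrow> nat \<Rightarrow> ('a list \<Rightarrow> 'a \<Rightarrow> real) \<Rightarrow> 'a list \<Rightarrow> 'a \<Rightarrow> nat" where
  "tau A m p x a =
     (LEAST i. i < m \<and>
        ((\<forall>y\<in>nlists (m - i - 1) A. p (y @ drop (m - i - 1) x) a = 0) \<or>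
         (\<forall>y\<in>nlists (m - i - 1) A. p (y @ drop (m - i - 1) x) a > 0)))"

definition skeleton_order :: "'a set \<Rightarrow> nat \<Rightarrow> ('a list \<Rightarrow> 'a \<Rightarrow> real) \<Rightarrow> nat" where
  "skeleton_order A m p = 1 + (SUP x\<in>nlists m A. SUP a\<in>A. tau A m p x a)"

text \<open>The parameter \<open>K\<close> is meant to be the order of the skeleton of \<open>p\<close>.\<close>

definition skeleton_matrix ::
    "'a set \<Rightarrow> nat \<Rightarrow> ('a list \<Rightarrow> 'a \<Rightarrow> real) \<Rightarrow> nat \<Rightarrow> 'a list \<Rightarrow> 'a list \<Rightarrow> bool" where
  "skeleton_matrix A m p K u v \<longleftrightarrow>
     (\<exists>x\<in>nlists K A. \<exists>a\<in>A. u = x \<and> v = tl x @ [a] \<and> (\<forall>y\<in>nlists (m - K) A. p (y @ x) a > 0))"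

end

theory Submission
  imports Defs
begin

text \<open>
  Whether \<open>p(x, a) > 0\<close> depends only on \<open>a\<close> and the last \<open>K\<close> symbols of \<open>x\<close>, so paths of \<open>\<M>\<close> lift
  to paths of \<open>\<P>\<close>. A finite directed graph has a unique closed class iff it is nonempty
  and any two vertices have a common descendant. Given two words in \<open>A\<^sup>m\<close>, lift paths of
  \<open>\<M>\<close> from their suffixes to a common descendant; the two words reached agree in the last \<open>K\<close>
  symbols, so the same symbols can be appended to both until they coincide.
\<close>

declare nlistsE_length [simp del] nlistsE_set [simp del] \<comment> \<open>these loop with \<open>nlists_def\<close>\<close>

section \<open>Closed classes of finite directed graphs\<close>

text \<open>Closedness traps every descendant of a member inside its class, so the class is the
  whole descendant set of that member. Mutual accessibility then amounts to every descendant leading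
  back.\<close>

lemma closed_class_iff:
  assumes R: "\<And>x y. R x y \<Longrightarrow> x \<in> E \<and> y \<in> E"
  shows "closed_class E (\<lambda>n. R ^^ n) C \<longleftrightarrow>
    (\<exists>k\<in>E. C = {l. R\<^sup>*\<^sup>* k l} \<and> (\<forall>l. R\<^sup>*\<^sup>* k l \<longrightarrow> R\<^sup>*\<^sup>* l k))"
proof -
  have acc: "accessible (\<lambda>n. R ^^ n) k l \<longleftrightarrow> R\<^sup>*\<^sup>* k l" for k l
    by (simp add: accessible_def rtranclp_power)
  have E: "l \<in> E" if "R\<^sup>*\<^sup>* k l" "k \<in> E" for k l
    using that by (induction) (auto dest: R)
  show ?thesis
  proof
    assume C: "closed_class E (\<lambda>n. R ^^ n) C"
    then obtain k where k: "k \<in> E" and Ck: "C = {l \<in> E. R\<^sup>*\<^sup>* k l \<and> R\<^sup>*\<^sup>* l k}"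
      by (auto simp: closed_class_def communicating_classes_def quotient_def acc)
    have "l \<in> C" if l: "R\<^sup>*\<^sup>* k l" for l
    proof (rule ccontr)
      assume "l \<notin> C"
      moreover have "k \<in> C"
        using k Ck by simp
      moreover have "l \<in> E"
        using E l k .
      moreover obtain n where "(R ^^ n) k l"
        using l by (auto simp: rtranclp_power)
      \<comment> \<open>\<open>closed_class\<close> only forbids exits after at least one step. A
        path of length 0 would give \<open>l = k\<close>, contradicting
        \<open>l \<notin> C\<close>.\<close>
      moreover from this \<open>k \<in> C\<close> \<open>l \<notin> C\<close> have "n \<ge> 1"
        by (cases n) auto
      ultimately show False
        using C unfolding closed_class_def by blast
    qed
    then show "\<exists>k\<in>E. C = {l. R\<^sup>*\<^sup>* k l} \<and> (\<forall>l. R\<^sup>*\<^sup>* k l \<longrightarrow> R\<^sup>*\<^sup>* l k)"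
      using k Ck by blast
  next
    assume "\<exists>k\<in>E. C = {l. R\<^sup>*\<^sup>* k l} \<and> (\<forall>l. R\<^sup>*\<^sup>* k l \<longrightarrow> R\<^sup>*\<^sup>* l k)"
    then obtain k where k: "k \<in> E" and Ck: "C = {l. R\<^sup>*\<^sup>* k l}"
      and Ck_back: "\<And>l. R\<^sup>*\<^sup>* k l \<Longrightarrow> R\<^sup>*\<^sup>* l k"
      by blast
    have "C = {(k, l). k \<in> E \<and> l \<in> E \<and> R\<^sup>*\<^sup>* k l \<and> R\<^sup>*\<^sup>* l k} `` {k}"
      using k Ck_back E by (auto simp: Ck)
    then have "C \<in> communicating_classes E (\<lambda>n. R ^^ n)"
      using quotientI[OF k] unfolding communicating_classes_def acc by (simp only:)
    moreover have "l \<in> C" if "j \<in> C" "(R ^^ n) j l" for j l n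
      using that Ck by (auto dest: relpowp_imp_rtranclp)
    ultimately show "closed_class E (\<lambda>n. R ^^ n) C"
      by (auto simp: closed_class_def)
  qed
qed

text \<open>Take a descendant \<open>j\<close> of \<open>k\<close> with the fewest descendants.
  Anything reachable from \<open>j\<close> has a descendant set contained in that of
  \<open>j\<close> and not smaller, hence equal to it, so it leads back to \<open>j\<close>.\<close>

lemma ex_closed_class_reachable:
  assumes "finite E" and R: "\<And>x y. R x y \<Longrightarrow> x \<in> E \<and> y \<in> E" and "k \<in> E"
  shows "\<exists>j. R\<^sup>*\<^sup>* k j \<and> closed_class E (\<lambda>n. R ^^ n) {l. R\<^sup>*\<^sup>* j l}"
proof -
  have E: "l \<in> E" if "R\<^sup>*\<^sup>* k l" for l
    using that \<open>k \<in> E\<close> by (induction) (auto dest: R)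
  define f where "f j = card {l. R\<^sup>*\<^sup>* j l}" for j
  obtain j where kj: "R\<^sup>*\<^sup>* k j" and min: "\<And>l. R\<^sup>*\<^sup>* k l \<Longrightarrow> f j \<le> f l"
    using ex_has_least_nat[of "R\<^sup>*\<^sup>* k" k f] by auto
  have fin: "finite {l. R\<^sup>*\<^sup>* j l}"
    using \<open>finite E\<close> E kj by (auto intro: finite_subset rtranclp_trans)
  have "R\<^sup>*\<^sup>* l j" if l: "R\<^sup>*\<^sup>* j l" for l
  proof -
    have "{z. R\<^sup>*\<^sup>* l z} \<subseteq> {z. R\<^sup>*\<^sup>* j z}"
      using l by auto
    moreover have "f j \<le> f l"
      using min kj l by (meson rtranclp_trans)
    ultimately have "{z. R\<^sup>*\<^sup>* l z} = {z. R\<^sup>*\<^sup>* j z}"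
      using fin by (intro card_seteq) (auto simp: f_def)
    then show ?thesis
      by blast
  qed
  then show ?thesis
    using kj E by (auto simp: closed_class_iff[OF R])
qed

text \<open>Each vertex reaches some closed class. If there is only one, the paths from
  \<open>k\<close> and \<open>l\<close> end in the same class and can be continued to a common
  vertex. Conversely, a common descendant of members of two closed classes leads back into either,
  so the classes coincide.\<close>

lemma unique_closed_class_iff:
  assumes "finite E" and R: "\<And>x y. R x y \<Longrightarrow> x \<in> E \<and> y \<in> E"
  shows "(\<exists>!C. closed_class E (\<lambda>n. R ^^ n) C) \<longleftrightarrow>
    E \<noteq> {} \<and> (\<forall>k\<in>E. \<forall>l\<in>E. \<exists>j. R\<^sup>*\<^sup>* k j \<and> R\<^sup>*\<^sup>* l j)"
proof
  assume unique: "\<exists>!C. closed_class E (\<lambda>n. R ^^ n) C"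
  have "\<exists>j. R\<^sup>*\<^sup>* k j \<and> R\<^sup>*\<^sup>* l j" if kl: "k \<in> E" "l \<in> E" for k l
  proof -
    obtain k' where k': "R\<^sup>*\<^sup>* k k'" "closed_class E (\<lambda>n. R ^^ n) {z. R\<^sup>*\<^sup>* k' z}"
      using ex_closed_class_reachable[of E R k, OF assms kl(1)] by blast
    obtain l' where l': "R\<^sup>*\<^sup>* l l'" "closed_class E (\<lambda>n. R ^^ n) {z. R\<^sup>*\<^sup>* l' z}"
      using ex_closed_class_reachable[of E R l, OF assms kl(2)] by blast
    have "{z. R\<^sup>*\<^sup>* k' z} = {z. R\<^sup>*\<^sup>* l' z}"
      by (rule alt_ex1E[OF unique]) (use k'(2) l'(2) in \<open>simp only:\<close>)
    then have "R\<^sup>*\<^sup>* k' l'"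
      by blast
    then show ?thesis
      using k' l' by (meson rtranclp_trans)
  qed
  moreover have "E \<noteq> {}"
    using unique by (auto simp: closed_class_iff[OF R])
  ultimately show "E \<noteq> {} \<and> (\<forall>k\<in>E. \<forall>l\<in>E. \<exists>j. R\<^sup>*\<^sup>* k j \<and> R\<^sup>*\<^sup>* l j)"
    by blast
next
  assume confl: "E \<noteq> {} \<and> (\<forall>k\<in>E. \<forall>l\<in>E. \<exists>j. R\<^sup>*\<^sup>* k j \<and> R\<^sup>*\<^sup>* l j)"
  then have "\<exists>C. closed_class E (\<lambda>n. R ^^ n) C"
    using ex_closed_class_reachable[of E R, OF assms] by blast
  moreover have "C \<subseteq> D"
    if C: "closed_class E (\<lambda>n. R ^^ n) C" and D: "closed_class E (\<lambda>n. R ^^ n) D" for C D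
  proof -
    obtain k where k: "k \<in> E" "C = {z. R\<^sup>*\<^sup>* k z}" "\<And>z. R\<^sup>*\<^sup>* k z \<Longrightarrow> R\<^sup>*\<^sup>* z k"
      using C by (simp only: closed_class_iff[OF R]) blast
    obtain l where l: "l \<in> E" "D = {z. R\<^sup>*\<^sup>* l z}"
      using D by (simp only: closed_class_iff[OF R]) blast
    obtain j where "R\<^sup>*\<^sup>* k j" "R\<^sup>*\<^sup>* l j"
      using confl k(1) l(1) by blast
    then have "R\<^sup>*\<^sup>* l k"
      using k by (meson rtranclp_trans)
    then show ?thesis
      using k l by auto
  qed
  ultimately show "\<exists>!C. closed_class E (\<lambda>n. R ^^ n) C"
    by (metis subset_antisym)
qed

section \<open>Positive entries of matrix powers\<close>

text \<open>Classes are subsets of \<open>E\<close>, so only rows indexed by \<open>E\<close> are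
  ever consulted. This serves to replace real matrix powers by relational ones.\<close>

lemma closed_class_cong:
  assumes "\<And>n k l. k \<in> E \<Longrightarrow> Q n k l = Q' n k l"
  shows "closed_class E Q C = closed_class E Q' C"
proof -
  have "communicating_classes E Q = communicating_classes E Q'"
    unfolding communicating_classes_def accessible_def using assms
    by (intro arg_cong2[where f = "(//)"]) auto
  moreover have "C \<subseteq> E" if "C \<in> communicating_classes E Q'"
    using that by (auto simp: communicating_classes_def quotient_def)
  ultimately show ?thesis
    using assms unfolding closed_class_def by (metis subsetD)
qed

text \<open>Nonnegative terms cannot cancel, so an entry of a product is positive iff one of its
  terms is. Nonnegativity of the powers is carried through the same induction because this argument
  needs it.\<close>

lemma matrix_power_pos_iff:
  assumes "finite E" and nonneg: "\<And>j l. j \<in> E \<Longrightarrow> P j l \<ge> 0"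
  shows "matrix_power E P n k l \<ge> 0 \<and>
    (k \<in> E \<longrightarrow> (matrix_power E P n k l > 0 \<longleftrightarrow> ((\<lambda>j l. j \<in> E \<and> P j l > 0) ^^ n) k l))"
proof (induction n arbitrary: l)
  case 0
  then show ?case by simp
next
  case (Suc n)
  let ?R = "\<lambda>j l. j \<in> E \<and> P j l > 0"
  have terms: "0 \<le> matrix_power E P n k j * P j l" if "j \<in> E" for j
    using Suc nonneg that by simp
  then have ge: "matrix_power E P (Suc n) k l \<ge> 0"
    by (simp add: sum_nonneg)
  have "matrix_power E P (Suc n) k l > 0 \<longleftrightarrow> (?R ^^ Suc n) k l" if "k \<in> E"
  proof -
    have "matrix_power E P (Suc n) k l > 0 \<longleftrightarrow>
        (\<exists>j\<in>E. matrix_power E P n k j * P j l \<noteq> 0)"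
      using ge terms \<open>finite E\<close> by (auto simp: less_le sum_nonneg_eq_0_iff)
    also have "\<dots> \<longleftrightarrow> (\<exists>j\<in>E. matrix_power E P n k j > 0 \<and> P j l > 0)"
      using Suc nonneg by (auto simp: less_le)
    also have "\<dots> \<longleftrightarrow> (?R ^^ Suc n) k l"
      using Suc that by auto
    finally show ?thesis .
  qed
  with ge show ?case by blast
qed

section \<open>Positivity of the kernel and the order of the skeleton\<close>

lemma finite_nlists: "finite A \<Longrightarrow> finite (nlists n A)"
  using finite_lists_length_eq[of A n] by (simp add: nlists_def conj_commute)

text \<open>The \<open>LEAST\<close> is attained because \<open>m - 1\<close> qualifies: the only
  prefix is then the empty word, and the nonnegative number \<open>p x a\<close> is zero or
  positive.\<close>

lemma tau_less:
  assumes "kernel A m p" "m \<ge> 1" "x \<in> nlists m A" "a \<in> A"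
  shows "tau A m p x a < m"
    and "(\<forall>y\<in>nlists (m - tau A m p x a - 1) A. p (y @ drop (m - tau A m p x a - 1) x) a = 0) \<or>
      (\<forall>y\<in>nlists (m - tau A m p x a - 1) A. p (y @ drop (m - tau A m p x a - 1) x) a > 0)"
proof -
  let ?Q = "\<lambda>i. i < m \<and>
        ((\<forall>y\<in>nlists (m - i - 1) A. p (y @ drop (m - i - 1) x) a = 0) \<or>
         (\<forall>y\<in>nlists (m - i - 1) A. p (y @ drop (m - i - 1) x) a > 0))"
  have "p x a \<ge> 0"
    using assms by (auto simp: kernel_def)
  then have "?Q (m - 1)"
    using \<open>m \<ge> 1\<close> by (auto simp: less_le nlists_def)
  then have "?Q (tau A m p x a)"
    unfolding tau_def by (rule LeastI)
  then show "tau A m p x a < m"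
    and "(\<forall>y\<in>nlists (m - tau A m p x a - 1) A. p (y @ drop (m - tau A m p x a - 1) x) a = 0) \<or>
      (\<forall>y\<in>nlists (m - tau A m p x a - 1) A. p (y @ drop (m - tau A m p x a - 1) x) a > 0)"
    by blast+
qed

lemma skeleton_order_le:
  assumes "kernel A m p" "m \<ge> 1" "A \<noteq> {}"
  shows "skeleton_order A m p \<le> m"
proof -
  have "nlists m A \<noteq> {}"
    using nlists_not_empty[OF assms(3)] by blast
  moreover have "tau A m p x a \<le> m - 1" if "x \<in> nlists m A" "a \<in> A" for x a
    using tau_less(1)[OF assms(1,2) that] by simp
  ultimately have "(SUP x\<in>nlists m A. SUP a\<in>A. tau A m p x a) \<le> m - 1"
    using \<open>A \<noteq> {}\<close> by (intro cSUP_least)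
  then show ?thesis
    using \<open>m \<ge> 1\<close> by (simp add: skeleton_order_def)
qed

lemma tau_less_skeleton_order:
  assumes "finite A" "x \<in> nlists m A" "a \<in> A"
  shows "tau A m p x a < skeleton_order A m p"
proof -
  have "tau A m p x a \<le> (SUP a\<in>A. tau A m p x a)"
    using assms by (intro cSUP_upper) auto
  also have "\<dots> \<le> (SUP x\<in>nlists m A. SUP a\<in>A. tau A m p x a)"
    using assms finite_nlists[of A m] by (intro cSUP_upper) auto
  finally show ?thesis
    by (simp add: skeleton_order_def)
qed

text \<open>Positivity at \<open>x\<close> itself rules out the all-zero alternative in
  \<open>tau\<close>, so the symbols before the suffix that \<open>tau\<close> selects are free. The
  last \<open>K\<close> symbols contain that suffix, since \<open>tau\<close> is less than the
  order.\<close>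

lemma kernel_pos_cong_suffix:
  assumes "kernel A m p" "m \<ge> 1" "finite A"
    and x: "x \<in> nlists m A" and a: "a \<in> A" and "p x a > 0"
    and y: "y \<in> nlists (m - skeleton_order A m p) A"
  shows "p (y @ drop (m - skeleton_order A m p) x) a > 0"
proof -
  \<comment> \<open>\<open>d\<close> and \<open>e\<close> are the lengths of the prefixes left free
    by \<open>tau\<close> and by the order of the skeleton; they satisfy
    \<open>e \<le> d\<close>.\<close>
  define d where "d = m - tau A m p x a - 1"
  define e where "e = m - skeleton_order A m p"
  have "e \<le> d"
    using tau_less_skeleton_order[OF assms(3) x a, of p] by (simp add: d_def e_def)
  have len: "length x = m" "set x \<subseteq> A" "d \<le> m"
    using x by (auto simp: nlists_def d_def)
  have "(\<forall>y\<in>nlists d A. p (y @ drop d x) a = 0) \<or> (\<forall>y\<in>nlists d A. p (y @ drop d x) a > 0)"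
    using tau_less(2)[OF assms(1,2) x a] unfolding d_def .
  moreover have "take d x \<in> nlists d A"
    using len by (auto simp: nlists_def dest: in_set_takeD)
  moreover have "p (take d x @ drop d x) a > 0"
    using \<open>p x a > 0\<close> by simp
  ultimately have pos: "\<And>y. y \<in> nlists d A \<Longrightarrow> p (y @ drop d x) a > 0"
    by fastforce
  \<comment> \<open>The symbols of \<open>x\<close> between positions \<open>e\<close> and
    \<open>d\<close> stay fixed here but are free for \<open>tau\<close>, so they are counted with
    the prefix.\<close>
  have "y @ take (d - e) (drop e x) \<in> nlists d A"
    using y len \<open>e \<le> d\<close>
    by (auto simp: nlists_def e_def[symmetric] dest!: in_set_takeD in_set_dropD)
  moreover have "drop e x = take (d - e) (drop e x) @ drop d x"
    using \<open>e \<le> d\<close> by (metis append_take_drop_id drop_drop le_add_diff_inverse2)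
  ultimately show ?thesis
    using pos[of "y @ take (d - e) (drop e x)"] by (simp add: e_def[symmetric])
qed

section \<open>Lifting and synchronising paths\<close>

lemma transition_matrix_pos_iff:
  "transition_matrix A m p x z > 0 \<longleftrightarrow>
    x \<in> nlists m A \<and> (\<exists>a\<in>A. z = tl x @ [a] \<and> p x a > 0)"
  by (auto simp: transition_matrix_def)

lemma kernel_ex_pos:
  assumes "kernel A m p" "x \<in> nlists m A"
  shows "\<exists>a\<in>A. p x a > 0"
proof (rule ccontr)
  assume "\<not> ?thesis"
  then have "(\<Sum>a\<in>A. p x a) \<le> 0"
    by (intro sum_nonpos) force
  then show False
    using assms by (auto simp: kernel_def)
qed

lemma tl_append_nlists:
  "\<lbrakk>x \<in> nlists n A; n \<ge> 1; a \<in> A\<rbrakk> \<Longrightarrow> tl x @ [a] \<in> nlists n A"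
  by (cases x) (auto simp: nlists_def)

lemma drop_tl_append:
  "k < length x \<Longrightarrow> drop k (tl x @ [a]) = tl (drop k x) @ [a]"
  by (cases x) (auto simp: drop_Suc tl_drop)

text \<open>An edge of the skeleton matrix demands positivity for every prefix, in particular for
  the one that the current lifted word happens to carry. The invariant is that the last
  \<open>K\<close> symbols of the lifted word form the current skeleton vertex.\<close>

lemma skeleton_path_lift:
  assumes M: "(skeleton_matrix A m p K)\<^sup>*\<^sup>* u v"
    and K: "1 \<le> K" "K \<le> m" and x: "x \<in> nlists m A" "drop (m - K) x = u"
  shows "\<exists>z\<in>nlists m A. (\<lambda>x z. transition_matrix A m p x z > 0)\<^sup>*\<^sup>* x z \<and> drop (m - K) z = v"
  using M
proof (induction)
  case base
  then show ?case using x by blast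
next
  case (step v w)
  then obtain z where z: "z \<in> nlists m A"
    "(\<lambda>x z. transition_matrix A m p x z > 0)\<^sup>*\<^sup>* x z" "drop (m - K) z = v"
    by blast
  from step(2) obtain a where a: "a \<in> A" "w = tl v @ [a]"
    and pos: "\<And>y. y \<in> nlists (m - K) A \<Longrightarrow> p (y @ v) a > 0"
    by (auto simp: skeleton_matrix_def)
  have "take (m - K) z \<in> nlists (m - K) A"
    using z by (auto simp: nlists_def dest: in_set_takeD)
  then have "p z a > 0"
    using pos z(3) by (metis append_take_drop_id)
  then have "transition_matrix A m p z (tl z @ [a]) > 0"
    using z a by (auto simp: transition_matrix_pos_iff)
  moreover have "drop (m - K) (tl z @ [a]) = w"
    using z a K by (subst drop_tl_append) (auto simp: nlists_def)
  moreover have "tl z @ [a] \<in> nlists m A"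
    using z a K by (intro tl_append_nlists) auto
  ultimately show ?case
    using z(2) by (intro bexI[of _ "tl z @ [a]"] conjI) (rule rtranclp.rtrancl_into_rtrancl)
qed

text \<open>\<open>k\<close> bounds the number of leading positions where the words may differ. As
  \<open>k \<le> m - K\<close>, they share their last \<open>K\<close> symbols, so a symbol possible
  after one is possible after the other. Appending it to both shifts out one leading
  position.\<close>

lemma transitions_synchronise:
  assumes "kernel A m p" "m \<ge> 1" "finite A"
    and K: "K = skeleton_order A m p" "K \<le> m"
    and x: "x \<in> nlists m A" "x' \<in> nlists m A" "drop k x = drop k x'" "k \<le> m - K"
  shows "\<exists>z. (\<lambda>x z. transition_matrix A m p x z > 0)\<^sup>*\<^sup>* x z \<and>
    (\<lambda>x z. transition_matrix A m p x z > 0)\<^sup>*\<^sup>* x' z"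
  using x
proof (induction k arbitrary: x x')
  case 0
  then show ?case by auto
next
  case (Suc k)
  obtain a where a: "a \<in> A" "p x a > 0"
    using kernel_ex_pos[OF assms(1) Suc.prems(1)] by blast
  have len: "length x = m" "length x' = m" "set x' \<subseteq> A"
    using Suc.prems by (auto simp: nlists_def)
  \<comment> \<open>The prefix of \<open>x'\<close> is put in front of the common suffix, which
    carries positivity over from \<open>x\<close> to \<open>x'\<close>.\<close>
  have "take (m - K) x' \<in> nlists (m - K) A"
    using len by (auto simp: nlists_def dest: in_set_takeD)
  then have "p (take (m - K) x' @ drop (m - K) x) a > 0"
    using kernel_pos_cong_suffix[OF assms(1-3) Suc.prems(1) a] K(1) by blast
  moreover have "drop (m - K) x = drop (m - K) x'"
    using Suc.prems by (metis drop_drop le_add_diff_inverse2)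
  ultimately have "p x' a > 0"
    by simp
  then have step: "transition_matrix A m p x (tl x @ [a]) > 0"
    "transition_matrix A m p x' (tl x' @ [a]) > 0"
    using Suc.prems a by (auto simp: transition_matrix_pos_iff)
  have "drop k (tl x @ [a]) = drop k (tl x' @ [a])"
    using Suc.prems len by (auto simp: drop_Suc)
  then have "\<exists>z. (\<lambda>x z. transition_matrix A m p x z > 0)\<^sup>*\<^sup>* (tl x @ [a]) z \<and>
    (\<lambda>x z. transition_matrix A m p x z > 0)\<^sup>*\<^sup>* (tl x' @ [a]) z"
    using Suc.prems a assms(2) by (intro Suc.IH tl_append_nlists) auto
  then show ?case
    using step by (meson converse_rtranclp_into_rtranclp)
qed

theorem corollary1:
  fixes A :: "'a set" and m K :: nat and p :: "'a list \<Rightarrow> 'a \<Rightarrow> real"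
    and \<Omega> :: "'b measure" and X :: "nat \<Rightarrow> 'b \<Rightarrow> 'a"
  assumes "finite A" and "m \<ge> 1"
    and "markov_chain A m p \<Omega> X"
    and "K = skeleton_order A m p"
    and "\<exists>!C. binary_closed_class (nlists K A) (skeleton_matrix A m p K) C"
  shows "essentially_irreducible A m p"
proof -
  let ?M = "skeleton_matrix A m p K"
  let ?R = "\<lambda>x z. transition_matrix A m p x z > 0"
  have ker: "kernel A m p"
    using assms(3) by (simp add: markov_chain_def)
  have "K \<ge> 1"
    using assms(4) by (simp add: skeleton_order_def)
  have M: "u \<in> nlists K A \<and> v \<in> nlists K A" if "?M u v" for u v
    using that \<open>K \<ge> 1\<close> by (auto simp: skeleton_matrix_def intro: tl_append_nlists)
  have confl: "nlists K A \<noteq> {}"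
    "\<And>u v. \<lbrakk>u \<in> nlists K A; v \<in> nlists K A\<rbrakk> \<Longrightarrow> \<exists>w. ?M\<^sup>*\<^sup>* u w \<and> ?M\<^sup>*\<^sup>* v w"
    using assms(5) unique_closed_class_iff[of "nlists K A" ?M, OF finite_nlists[OF assms(1)] M]
    by (simp_all add: binary_closed_class_def)
  \<comment> \<open>A word of length \<open>K \<ge> 1\<close> over \<open>A\<close> exists, because
    a closed class of the skeleton matrix does.\<close>
  have "A \<noteq> {}"
    using confl(1) \<open>K \<ge> 1\<close> by (auto simp: nlists_def)
  then have nonempty: "nlists m A \<noteq> {}"
    using nlists_not_empty by blast
  have "K \<le> m"
    using skeleton_order_le[OF ker assms(2) \<open>A \<noteq> {}\<close>] assms(4) by simp
  have R: "x \<in> nlists m A \<and> z \<in> nlists m A" if "?R x z" for x z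
    using that \<open>m \<ge> 1\<close> by (auto simp: transition_matrix_pos_iff intro: tl_append_nlists)
  have "\<exists>z. ?R\<^sup>*\<^sup>* x z \<and> ?R\<^sup>*\<^sup>* x' z" if x: "x \<in> nlists m A" "x' \<in> nlists m A" for x x'
  proof -
    have "drop (m - K) x \<in> nlists K A" "drop (m - K) x' \<in> nlists K A"
      using x \<open>K \<le> m\<close> by (auto simp: nlists_def dest: in_set_dropD)
    then obtain w where w: "?M\<^sup>*\<^sup>* (drop (m - K) x) w" "?M\<^sup>*\<^sup>* (drop (m - K) x') w"
      using confl(2) by blast
    obtain z where z: "z \<in> nlists m A" "?R\<^sup>*\<^sup>* x z" "drop (m - K) z = w"
      using skeleton_path_lift[OF w(1) \<open>K \<ge> 1\<close> \<open>K \<le> m\<close> x(1)] by blast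
    obtain z' where z': "z' \<in> nlists m A" "?R\<^sup>*\<^sup>* x' z'" "drop (m - K) z' = w"
      using skeleton_path_lift[OF w(2) \<open>K \<ge> 1\<close> \<open>K \<le> m\<close> x(2)] by blast
    \<comment> \<open>\<open>m - K\<close> is the largest disagreement that synchronisation admits,
      and the lifted words are only known to agree beyond it.\<close>
    obtain t where "?R\<^sup>*\<^sup>* z t" "?R\<^sup>*\<^sup>* z' t"
      using transitions_synchronise[OF ker assms(2,1,4) \<open>K \<le> m\<close> z(1) z'(1), of "m - K"] z(3) z'(3)
      by auto
    then show ?thesis
      using z(2) z'(2) by (meson rtranclp_trans)
  qed
  then have "\<exists>!C. closed_class (nlists m A) (\<lambda>n. ?R ^^ n) C"
    using unique_closed_class_iff[of "nlists m A" ?R, OF finite_nlists[OF assms(1)] R] nonempty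
    by blast
  moreover have "recurrent_class (nlists m A) (transition_matrix A m p) C =
      closed_class (nlists m A) (\<lambda>n. ?R ^^ n) C" for C
    unfolding recurrent_class_def
  proof (rule closed_class_cong)
    fix n k l
    assume k: "k \<in> nlists m A"
    have "transition_matrix A m p x z \<ge> 0" if "x \<in> nlists m A" for x z
      using ker that by (auto simp: transition_matrix_def kernel_def)
    \<comment> \<open>The row restriction in \<open>matrix_power_pos_iff\<close> is already built
      into the support of the transition matrix.\<close>
    moreover have "(\<lambda>x z. x \<in> nlists m A \<and> ?R x z) = ?R"
      using R by blast
    ultimately show "(matrix_power (nlists m A) (transition_matrix A m p) n k l > 0) = (?R ^^ n) k l"
      using matrix_power_pos_iff[of "nlists m A" "transition_matrix A m p" n k l]
        finite_nlists[OF assms(1)] k by simp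
  qed
  ultimately show ?thesis
    by (simp add: essentially_irreducible_def)
qed

end
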